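(* Let $\Pi$ be a well-conditioned probability measure on $\mathbb{R}^d$ with potential $U$ such that $\nabla^2U$ is of multiplicative form, meaning it can be written $\nabla^2U(x)=Z^T\Lambda(x)Z$ with $Z\in\mathbb{R}^{n\times d}$, $n\ge d$, and $\Lambda(x)\in\mathbb{R}^{n\times n}$. Let $\tilde\kappa$ denote the condition number after preconditioning with $L$. (i) Choosing either $L=(Z^TZ)^{1/2}$, or $L=R$ where $QR$ is a reduced QR decomposition of $Z$, gives \[ \tilde\kappa\le\frac{\sup_{x\in\mathbb{R}^d}\lambda_1(\Lambda(x))}{\inf_{x\in\mathbb{R}^d}\lambda_d(\Lambda(x))}. \] (ii) Choosing $L=(Z^T\Lambda(x^* )Z)^{1/2}$ gives \[ \tilde\kappa\le\frac{\sup_{x\in\mathbb{R}^d}\lambda_1\bigl(\Lambda(x^* )^{-1/2}\Lambda(x)\Lambda(x^* )^{-1/2}\bigr)}{\inf_{x\in\mathbb{R}^d}\lambda_d\bigl(\Lambda(x^* )^{-1/2}\Lambda(x)\Lambda(x^* )^{-1/2}\bigr)} \] for any $x^*\in\mathbb{R}^d$.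
   Context: $\Pi$ has density $\propto\exp(-U)$, where $U$ is called the potential; $\Pi$ is well-conditioned if $U\in C^2(\mathbb{R}^d)$ and $m\mathbf{I}_d\preceq\nabla^2U(x)\preceq M\mathbf{I}_d$ for all $x$, for some $M\ge m>0$. The condition number after preconditioning with $L\in GL_d(\mathbb{R})$ (that is, of the law of $LX$, $X\sim\Pi$) is $\tilde\kappa=\sup_{x}\|L^{-T}\nabla^2U(x)L^{-1}\|\,\sup_{x}\|L\nabla^2U(x)^{-1}L^{T}\|$ (operator 2-norm). $\lambda_i(A)$ denotes the $i$-th largest eigenvalue of a symmetric matrix $A$. In the reduced QR decomposition $Z=QR$, $Q\in\mathbb{R}^{n\times d}$ has orthonormal columns and $R\in\mathbb{R}^{d\times d}$ is upper triangular.
   Formalization: The bounds as stated fail for n > d; the formal version has λ_n (smallest eigenvalue) in place of λ_d in both denominators, assumes Λ(x) symmetric positive semidefinite for all x, and in (ii) takes x* with Λ(x* ) positive definite. For n = d nothing changes. *)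

theory Defs
  imports "HOL-Probability.Probability"
begin

section \<open>Symmetric matrices\<close>

definition symmetric_mat :: "real^'n^'n \<Rightarrow> bool" where
  "symmetric_mat A \<longleftrightarrow> transpose A = A"

definition pos_semidef :: "real^'n^'n \<Rightarrow> bool" where
  "pos_semidef A \<longleftrightarrow> symmetric_mat A \<and> (\<forall>v. 0 \<le> v \<bullet> (A *v v))"

definition pos_def :: "real^'n^'n \<Rightarrow> bool" where
  "pos_def A \<longleftrightarrow> symmetric_mat A \<and> (\<forall>v. v \<noteq> 0 \<longrightarrow> 0 < v \<bullet> (A *v v))"

definition loewner_le :: "real^'n^'n \<Rightarrow> real^'n^'n \<Rightarrow> bool" (infix "\<preceq>\<^sub>L" 50) where
  "A \<preceq>\<^sub>L B \<longleftrightarrow> pos_semidef (B - A)"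

text \<open>The square root is only meaningful for positive semidefinite matrices,
  the inverse square root only for positive definite ones.\<close>

definition sqrt_mat :: "real^'n^'n \<Rightarrow> real^'n^'n" where
  "sqrt_mat A = (THE B. pos_semidef B \<and> B ** B = A)"

definition inv_sqrt_mat :: "real^'n^'n \<Rightarrow> real^'n^'n" where
  "inv_sqrt_mat A = matrix_inv (sqrt_mat A)"

definition eigenspace :: "real^'n^'n \<Rightarrow> real \<Rightarrow> (real^'n) set" where
  "eigenspace A \<mu> = {v. A *v v = \<mu> *\<^sub>R v}"

definition eigenvalues :: "real^'n^'n \<Rightarrow> real set" where
  "eigenvalues A = {\<mu>. \<exists>v. v \<noteq> 0 \<and> A *v v = \<mu> *\<^sub>R v}"

text \<open>Eigenvalues are repeated according to the dimension of their eigenspace, which for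
  symmetric matrices is the usual multiplicity. The index \<open>i\<close> runs from \<open>1\<close> (largest
  eigenvalue) to \<open>CARD('n)\<close> (smallest).\<close>

definition eigenvalue_mset :: "real^'n^'n \<Rightarrow> real multiset" where
  "eigenvalue_mset A = (\<Sum>\<mu>\<in>eigenvalues A. replicate_mset (dim (eigenspace A \<mu>)) \<mu>)"

definition eigval :: "nat \<Rightarrow> real^'n^'n \<Rightarrow> real" where
  "eigval i A = rev (sorted_list_of_multiset (eigenvalue_mset A)) ! (i - 1)"

definition op_norm :: "real^'n^'m \<Rightarrow> real" where
  "op_norm A = onorm ((*v) A)"

section \<open>Reduced QR decomposition\<close>

definition upper_triangular :: "real^('d::{finite,linorder})^('d::{finite,linorder}) \<Rightarrow> bool" where
  "upper_triangular R \<longleftrightarrow> (\<forall>i j. j < i \<longrightarrow> R $ i $ j = 0)"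

definition reduced_QR ::
  "real^('d::{finite,linorder})^'n \<Rightarrow> real^('d::{finite,linorder})^'n
     \<Rightarrow> real^('d::{finite,linorder})^('d::{finite,linorder}) \<Rightarrow> bool" where
  "reduced_QR Z Q R \<longleftrightarrow> transpose Q ** Q = mat 1 \<and> upper_triangular R \<and> Z = Q ** R"

section \<open>Potentials and well-conditioned measures\<close>

definition gradient :: "(real^'d \<Rightarrow> real) \<Rightarrow> real^'d \<Rightarrow> real^'d" where
  "gradient U x = (\<chi> i. frechet_derivative U (at x) (axis i 1))"

definition hessian :: "(real^'d \<Rightarrow> real) \<Rightarrow> real^'d \<Rightarrow> real^'d^'d" where
  "hessian U x = jacobian (gradient U) (at x)"

definition C2 :: "(real^'d \<Rightarrow> real) \<Rightarrow> bool" where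
  "C2 U \<longleftrightarrow> (\<forall>x. U differentiable (at x)) \<and> (\<forall>x. gradient U differentiable (at x))
     \<and> continuous_on UNIV (hessian U)"

definition has_potential :: "(real^'d) measure \<Rightarrow> (real^'d \<Rightarrow> real) \<Rightarrow> bool" where
  "has_potential P U \<longleftrightarrow> prob_space P \<and>
     (\<exists>c>0. P = density lborel (\<lambda>x. ennreal (c * exp (- U x))))"

definition well_conditioned :: "(real^'d) measure \<Rightarrow> (real^'d \<Rightarrow> real) \<Rightarrow> bool" where
  "well_conditioned P U \<longleftrightarrow> has_potential P U \<and> C2 U \<and>
     (\<exists>m M. 0 < m \<and> m \<le> M \<and> (\<forall>x. mat m \<preceq>\<^sub>L hessian U x \<and> hessian U x \<preceq>\<^sub>L mat M))"

definition multiplicative_form ::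
  "(real^'d \<Rightarrow> real) \<Rightarrow> real^'d^'n \<Rightarrow> (real^'d \<Rightarrow> real^'n^'n) \<Rightarrow> bool" where
  "multiplicative_form U Z \<Lambda> \<longleftrightarrow> CARD('d) \<le> CARD('n) \<and>
     (\<forall>x. symmetric_mat (\<Lambda> x) \<and> hessian U x = transpose Z ** \<Lambda> x ** Z)"

text \<open>Suprema and infima over all of \<open>\<real>\<^sup>d\<close> are taken in the extended reals, so that an
  unbounded family has supremum \<open>\<infinity>\<close> instead of an unspecified real value.\<close>

definition precond_cond_number :: "(real^'d \<Rightarrow> real) \<Rightarrow> real^'d^'d \<Rightarrow> ereal" where
  "precond_cond_number U L =
     (SUP x. ereal (op_norm (transpose (matrix_inv L) ** hessian U x ** matrix_inv L))) *
     (SUP x. ereal (op_norm (L ** matrix_inv (hessian U x) ** transpose L)))"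

text \<open>Caution: for \<open>n > d\<close> the condition number is controlled by the smallest eigenvalue \<open>\<lambda>\<^sub>n\<close> of
  the \<open>n \<times> n\<close> matrices \<open>\<Lambda>(x)\<close>, not by \<open>\<lambda>\<^sub>d\<close>. Take \<open>d = 1\<close>, \<open>n = 2\<close>, \<open>Z = (1, 0)\<^sup>T\<close>, \<open>L = 1\<close> and
  \<open>\<Lambda>(x) = diag(a(x), 1)\<close>, where \<open>U'' = a\<close> has infimum \<open>1/4\<close> and supremum \<open>1/2\<close>: the condition number
  is \<open>2\<close>, but \<open>\<lambda>\<^sub>d(\<Lambda>(x)) = \<lambda>\<^sub>1(\<Lambda>(x)) = 1\<close> for all \<open>x\<close>. For \<open>n = d\<close> both indices agree.\<close>

end

(* Every choice of L satisfies L^T L = Z^T Z, where in part (ii) Z and Lambda(x) are first replaced by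
   S Z and S^-1 Lambda(x) S^-1 with S = Lambda(xs)^(1/2), which leaves the Hessian unchanged.
   Then |L w| = |Z w|, so the Rayleigh bounds for Lambda(x) at Z w bound w^T H(x) w between
   lambda_n(Lambda(x)) |L w|^2 and lambda_1(Lambda(x)) |L w|^2. Substituting w = L^-1 v bounds
   L^-T H L^-1; substituting w = H^-1 L^T v, so that w^T H w = (L w)^T v, bounds L H^-1 L^T. *)
theory Submission
  imports Defs
begin

section \<open>Spectral theorem for real symmetric matrices\<close>

lemma symmetric_mat_dot:
  fixes A :: "real^'n^'n"
  assumes "symmetric_mat A"
  shows "x \<bullet> (A *v y) = (A *v x) \<bullet> y"
  using assms unfolding symmetric_mat_def
  by (metis dot_lmul_matrix transpose_matrix_vector)

lemma dot_transpose_mult: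
  fixes A :: "real^'n^'m"
  shows "x \<bullet> (transpose A *v y) = (A *v x) \<bullet> y"
  by (metis dot_lmul_matrix inner_commute transpose_matrix_vector)

text \<open>The usual discriminant argument: the form is nonnegative at every combination
  \<open>s x + t y\<close>. Nonnegativity is asked for on a subspace only, because the form of
  \<open>\<mu> - A\<close> built from a maximal Rayleigh quotient over \<open>S\<close> is
  nonnegative just on \<open>S\<close>.\<close>

lemma psd_form_Cauchy_Schwarz:
  fixes f :: "'a::real_inner \<Rightarrow> 'a"
  assumes f: "linear f" and S: "subspace S" "x \<in> S" "y \<in> S"
    and sym: "\<And>x y. x \<bullet> f y = f x \<bullet> y"
    and nn: "\<And>v. v \<in> S \<Longrightarrow> 0 \<le> v \<bullet> f v"
  shows "(x \<bullet> f y)\<^sup>2 \<le> (x \<bullet> f x) * (y \<bullet> f y)"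
proof -
  define a b c where "a = x \<bullet> f x" and "b = x \<bullet> f y" and "c = y \<bullet> f y"
  have yx: "y \<bullet> f x = b"
    unfolding b_def using sym[of y x] by (simp add: inner_commute)
  have q: "0 \<le> s\<^sup>2 * a + 2 * s * t * b + t\<^sup>2 * c" for s t
  proof -
    have "s *\<^sub>R x + t *\<^sub>R y \<in> S"
      using S by (intro subspace_add subspace_scale)
    then have "0 \<le> (s *\<^sub>R x + t *\<^sub>R y) \<bullet> f (s *\<^sub>R x + t *\<^sub>R y)"
      by (rule nn)
    also have "\<dots> = s\<^sup>2 * a + 2 * s * t * b + t\<^sup>2 * c"
      using yx by (simp add: linear_add[OF f] linear_scale[OF f]
          a_def b_def c_def power2_eq_square algebra_simps)
    finally show ?thesis .
  qed
  have a0: "0 \<le> a" and c0: "0 \<le> c"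
    using nn S by (auto simp: a_def c_def)
  have "b\<^sup>2 \<le> a * c"
  proof (cases "c = 0")
    case True
    have "b = 0"
    proof (rule ccontr)
      assume "b \<noteq> 0"
      \<comment> \<open>For \<open>c = 0\<close> and \<open>s = 1\<close> the form is affine in
        \<open>t\<close>; this \<open>t\<close> makes it \<open>a - (a + 1) = -1\<close>.\<close>
      then have "2 * (- (a + 1) / (2 * b)) * b = - (a + 1)"
        by simp
      with q[of 1 "- (a + 1) / (2 * b)"] True show False by simp
    qed
    then show ?thesis using True by simp
  next
    case False
    \<comment> \<open>At \<open>s = c\<close>, \<open>t = -b\<close> the form equals
      \<open>c * (a * c - b * b)\<close>.\<close>
    have "c * b\<^sup>2 \<le> c * (a * c)"
      using q[of c "-b"] by (simp add: power2_eq_square algebra_simps)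
    moreover have "0 < c" using False c0 by simp
    ultimately show ?thesis by (rule mult_left_le_imp_le)
  qed
  then show ?thesis by (simp add: a_def b_def c_def)
qed

text \<open>Variational argument: by compactness the quadratic form attains a maximum
  \<open>\<mu>\<close> on the unit sphere of \<open>S\<close>, and a maximizer is an eigenvector for
  \<open>\<mu>\<close>.\<close>

lemma symmetric_has_eigenvector_in_subspace:
  fixes A :: "real^'n^'n"
  assumes A: "symmetric_mat A" and S: "subspace S" "\<And>x. x \<in> S \<Longrightarrow> A *v x \<in> S" "S \<noteq> {0}"
  obtains v \<mu> where "v \<in> S" "norm v = 1" "A *v v = \<mu> *\<^sub>R v"
proof -
  let ?K = "S \<inter> sphere 0 1"
  have "0 \<in> S" using S(1) by (rule subspace_0)
  then obtain u where u: "u \<in> S" "u \<noteq> 0"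
    using S(3) by auto
  then have "u /\<^sub>R norm u \<in> ?K"
    using S(1) by (simp add: subspace_scale)
  then have ne: "?K \<noteq> {}" by blast
  have comp: "compact ?K"
    using closed_subspace[OF S(1)] by (intro closed_Int_compact compact_sphere)
  have cont: "continuous_on ?K (\<lambda>v. v \<bullet> (A *v v))"
    by (intro continuous_intros linear_continuous_on linear_conv_bounded_linear[THEN iffD1]
        matrix_vector_mul_linear)
  obtain v where v: "v \<in> ?K" and mx: "\<And>w. w \<in> ?K \<Longrightarrow> w \<bullet> (A *v w) \<le> v \<bullet> (A *v v)"
    using continuous_attains_sup[OF comp ne cont] by blast
  define \<mu> where "\<mu> = v \<bullet> (A *v v)"
  define f where "f = (\<lambda>x. \<mu> *\<^sub>R x - A *v x)"
  have lin: "linear f"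
    unfolding f_def by (intro linear_compose_sub linear_scaleR matrix_vector_mul_linear)
  have sym: "x \<bullet> f y = f x \<bullet> y" for x y
    by (simp add: f_def inner_diff_left inner_diff_right symmetric_mat_dot[OF A])
  have nn: "0 \<le> w \<bullet> f w" if "w \<in> S" for w
  proof (cases "w = 0")
    case False
    then have "w /\<^sub>R norm w \<in> ?K"
      using that S(1) by (simp add: subspace_scale)
    from mx[OF this] have "(w \<bullet> (A *v w)) / (norm w)\<^sup>2 \<le> \<mu>"
      by (simp add: \<mu>_def matrix_vector_mult_scaleR power2_eq_square divide_simps)
    then have "w \<bullet> (A *v w) \<le> \<mu> * (w \<bullet> w)"
      using False by (simp add: divide_simps power2_norm_eq_inner)
    then show ?thesis by (simp add: f_def inner_diff_right)
  qed simp
  have vS: "v \<in> S" "norm v = 1" using v by auto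
  have fS: "f v \<in> S"
    unfolding f_def using S vS by (intro subspace_diff subspace_scale) auto
  \<comment> \<open>The form of \<open>f\<close> is nonnegative on \<open>S\<close> and vanishes at \<open>v\<close>, so Cauchy-Schwarz kills \<open>f v\<close>.\<close>
  have "v \<bullet> f v = 0"
    using vS by (simp add: f_def inner_diff_right \<mu>_def flip: power2_norm_eq_inner)
  then have "(v \<bullet> f (f v))\<^sup>2 \<le> 0"
    using psd_form_Cauchy_Schwarz[OF lin S(1) vS(1) fS sym nn] by simp
  then have "f v = 0" using sym[of v "f v"] by simp
  then have "A *v v = \<mu> *\<^sub>R v" by (simp add: f_def)
  with vS show ?thesis by (rule that)
qed

text \<open>Induction on the dimension: split off a unit eigenvector \<open>v\<close>; by symmetry
  of \<open>A\<close> its orthogonal complement \<open>T\<close> in \<open>S\<close> is again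
  invariant. Invariant subspaces in place of the whole space are what the induction runs
  over.\<close>

lemma symmetric_eigenbasis_of_subspace:
  fixes A :: "real^'n^'n"
  assumes A: "symmetric_mat A" and S: "subspace S" "\<And>x. x \<in> S \<Longrightarrow> A *v x \<in> S"
  shows "\<exists>B \<subseteq> S. finite B \<and> pairwise orthogonal B \<and> (\<forall>b\<in>B. norm b = 1) \<and> span B = S
           \<and> (\<forall>b\<in>B. \<exists>\<mu>. A *v b = \<mu> *\<^sub>R b)"
  using S
proof (induction "dim S" arbitrary: S rule: less_induct)
  case less
  show ?case
  proof (cases "S = {0}")
    case True
    then show ?thesis by (intro exI[of _ "{}"]) auto
  next
    case False
    obtain v \<mu> where v: "v \<in> S" "norm v = 1" "A *v v = \<mu> *\<^sub>R v"
      using symmetric_has_eigenvector_in_subspace[OF A less.prems False] by blast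
    have vv: "v \<bullet> v = 1" using v(2) by (simp flip: power2_norm_eq_inner)
    define T where "T = {x \<in> S. v \<bullet> x = 0}"
    have T: "subspace T"
      using less.prems(1) unfolding T_def subspace_def by (auto simp: inner_add_right)
    have TS: "T \<subseteq> S" and vT: "v \<notin> T" using vv by (auto simp: T_def)
    then have "dim T < dim S"
      using T less.prems(1) v(1) by (intro dim_psubset) (auto simp: span_eq_iff[THEN iffD2])
    moreover have "A *v x \<in> T" if "x \<in> T" for x
      using that less.prems(2) v(3) by (auto simp: T_def symmetric_mat_dot[OF A])
    ultimately obtain B where B: "B \<subseteq> T" "finite B" "pairwise orthogonal B"
      "\<forall>b\<in>B. norm b = 1" "span B = T" "\<forall>b\<in>B. \<exists>\<mu>. A *v b = \<mu> *\<^sub>R b"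
      using less.hyps[OF _ T] by blast
    have "pairwise orthogonal (insert v B)"
      using B(1,3) by (auto simp: pairwise_insert orthogonal_def T_def inner_commute)
    moreover have "span (insert v B) = S"
    proof
      show "span (insert v B) \<subseteq> S"
        using B(1) TS v(1) less.prems(1) by (intro span_minimal) auto
      show "S \<subseteq> span (insert v B)"
      proof
        fix x assume "x \<in> S"
        then have "x - (v \<bullet> x) *\<^sub>R v \<in> T"
          using v(1) vv less.prems(1)
          by (simp add: T_def subspace_diff subspace_scale inner_diff_right)
        then show "x \<in> span (insert v B)"
          using B(5) by (auto simp: span_insert)
      qed
    qed
    ultimately show ?thesis
      using B TS v by (intro exI[of _ "insert v B"]) auto
  qed
qed

lemma independent_orthonormal:
  assumes "pairwise orthogonal B" "\<forall>b\<in>B. norm b = 1"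
  shows "independent B"
  using assms by (intro pairwise_orthogonal_independent) auto

section \<open>Eigenbases, ordered eigenvalues and Rayleigh bounds\<close>

text \<open>An orthonormal basis of eigenvectors. The eigenvalue of a unit eigenvector
  \<open>b\<close> is its Rayleigh quotient \<open>b \<bullet> (A *v b)\<close>, so no separate
  eigenvalue function has to be carried along.\<close>

definition eigenbasis :: "real^'n^'n \<Rightarrow> (real^'n) set \<Rightarrow> bool" where
  "eigenbasis A B \<longleftrightarrow> pairwise orthogonal B \<and> (\<forall>b\<in>B. norm b = 1) \<and> span B = UNIV
     \<and> (\<forall>b\<in>B. A *v b = (b \<bullet> (A *v b)) *\<^sub>R b)"

lemma symmetric_has_eigenbasis:
  assumes "symmetric_mat A"
  obtains B where "eigenbasis A B"
proof -
  obtain B where B: "pairwise orthogonal B" "\<forall>b\<in>B. norm b = 1" "span B = UNIV"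
    "\<forall>b\<in>B. \<exists>\<mu>. A *v b = \<mu> *\<^sub>R b"
    using symmetric_eigenbasis_of_subspace[OF assms subspace_UNIV] by auto
  have "A *v b = (b \<bullet> (A *v b)) *\<^sub>R b" if "b \<in> B" for b
  proof -
    obtain \<mu> where "A *v b = \<mu> *\<^sub>R b" using B(4) \<open>b \<in> B\<close> by blast
    moreover have "b \<bullet> b = 1"
      using B(2) \<open>b \<in> B\<close> by (simp flip: power2_norm_eq_inner)
    ultimately show ?thesis by simp
  qed
  then show ?thesis using B by (intro that[of B]) (auto simp: eigenbasis_def)
qed

context
  fixes A :: "real^'n^'n" and B
  assumes B: "eigenbasis A B"
begin

lemma eigenbasis_independent: "independent B"
  using B independent_orthonormal[of B] by (simp add: eigenbasis_def)

lemma eigenbasis_finite: "finite B"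
  using eigenbasis_independent by (rule finiteI_independent)

lemma eigenbasis_card: "card B = CARD('n)"
  using B dim_eq_card[OF _ eigenbasis_independent, of UNIV] by (simp add: eigenbasis_def)

lemma eigenbasis_dot:
  assumes "b \<in> B" "c \<in> B"
  shows "b \<bullet> c = (if b = c then 1 else 0)"
  using B assms by (auto simp: eigenbasis_def pairwise_def orthogonal_def simp flip: power2_norm_eq_inner)

lemma eigenbasis_expand: "(\<Sum>b\<in>B. (b \<bullet> x) *\<^sub>R b) = x"
  using B orthonormal_basis_expand[of B x] eigenbasis_finite
  by (simp add: eigenbasis_def inner_commute)

lemma eigenbasis_eigen: "b \<in> B \<Longrightarrow> A *v b = (b \<bullet> (A *v b)) *\<^sub>R b"
  using B by (auto simp: eigenbasis_def)

lemma eigenbasis_mult: "A *v x = (\<Sum>b\<in>B. ((b \<bullet> x) * (b \<bullet> (A *v b))) *\<^sub>R b)"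
proof -
  have "A *v x = A *v (\<Sum>b\<in>B. (b \<bullet> x) *\<^sub>R b)" by (simp only: eigenbasis_expand)
  also have "\<dots> = (\<Sum>b\<in>B. (b \<bullet> x) *\<^sub>R (A *v b))"
    by (simp add: linear_sum[OF matrix_vector_mul_linear] matrix_vector_mult_scaleR)
  also have "\<dots> = (\<Sum>b\<in>B. ((b \<bullet> x) * (b \<bullet> (A *v b))) *\<^sub>R b)"
    by (intro sum.cong refl) (metis eigenbasis_eigen scaleR_scaleR)
  finally show ?thesis .
qed

lemma eigenbasis_coeff:
  assumes "b \<in> B"
  shows "b \<bullet> (\<Sum>c\<in>B. g c *\<^sub>R c) = g b"
  using assms eigenbasis_finite by (simp add: inner_sum_right eigenbasis_dot if_distrib cong: if_cong)

lemma eigenbasis_quadratic_form: "x \<bullet> (A *v x) = (\<Sum>b\<in>B. (b \<bullet> (A *v b)) * (b \<bullet> x)\<^sup>2)"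
  by (subst eigenbasis_mult) (simp add: inner_sum_right inner_commute power2_eq_square mult_ac)

lemma eigenbasis_norm: "x \<bullet> x = (\<Sum>b\<in>B. (b \<bullet> x)\<^sup>2)"
proof -
  have "x \<bullet> x = x \<bullet> (\<Sum>b\<in>B. (b \<bullet> x) *\<^sub>R b)" by (simp only: eigenbasis_expand)
  also have "\<dots> = (\<Sum>b\<in>B. (b \<bullet> x)\<^sup>2)"
    by (simp add: inner_sum_right inner_commute[of x] power2_eq_square)
  finally show ?thesis .
qed

text \<open>Comparing coefficients in \<open>A *v x = \<nu> *\<^sub>R x\<close> shows that
  \<open>x\<close> has a zero coefficient at every basis vector whose eigenvalue differs from
  \<open>\<nu>\<close>. Multiplicities thereby become cardinalities of subsets of
  \<open>B\<close>.\<close>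

lemma eigenbasis_eigenspace: "eigenspace A \<nu> = span {b \<in> B. b \<bullet> (A *v b) = \<nu>}"
proof
  show "span {b \<in> B. b \<bullet> (A *v b) = \<nu>} \<subseteq> eigenspace A \<nu>"
  proof (rule span_minimal)
    show "{b \<in> B. b \<bullet> (A *v b) = \<nu>} \<subseteq> eigenspace A \<nu>"
      unfolding eigenspace_def using eigenbasis_eigen by auto
    show "subspace (eigenspace A \<nu>)"
      unfolding eigenspace_def subspace_def
      by (auto simp: matrix_vector_right_distrib matrix_vector_mult_scaleR scaleR_add_right)
  qed
  show "eigenspace A \<nu> \<subseteq> span {b \<in> B. b \<bullet> (A *v b) = \<nu>}"
  proof
    fix x assume "x \<in> eigenspace A \<nu>"
    then have Ax: "A *v x = \<nu> *\<^sub>R x" by (simp add: eigenspace_def)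
    have "(b \<bullet> x) *\<^sub>R b \<in> span {b \<in> B. b \<bullet> (A *v b) = \<nu>}" if "b \<in> B" for b
    proof -
      have "\<nu> * (b \<bullet> x) = (b \<bullet> x) * (b \<bullet> (A *v b))"
        using arg_cong[OF eigenbasis_mult, of "inner b" x] eigenbasis_coeff[OF that]
        by (simp add: Ax)
      then have "b \<bullet> x = 0 \<or> b \<bullet> (A *v b) = \<nu>" by auto
      then show ?thesis using that by (auto intro: span_base span_scale span_zero)
    qed
    then have "(\<Sum>b\<in>B. (b \<bullet> x) *\<^sub>R b) \<in> span {b \<in> B. b \<bullet> (A *v b) = \<nu>}"
      by (rule span_sum)
    then show "x \<in> span {b \<in> B. b \<bullet> (A *v b) = \<nu>}" by (simp only: eigenbasis_expand)
  qed
qed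

lemma eigenbasis_dim_eigenspace: "dim (eigenspace A \<nu>) = card {b \<in> B. b \<bullet> (A *v b) = \<nu>}"
  unfolding eigenbasis_eigenspace dim_span
  by (intro dim_eq_card_independent independent_mono[OF eigenbasis_independent]) auto

lemma eigenbasis_eigenvalues: "eigenvalues A = (\<lambda>b. b \<bullet> (A *v b)) ` B"
proof -
  have "\<nu> \<in> eigenvalues A \<longleftrightarrow> \<not> eigenspace A \<nu> \<subseteq> {0}" for \<nu>
    by (auto simp: eigenvalues_def eigenspace_def)
  also have "\<dots> \<nu> \<longleftrightarrow> dim (eigenspace A \<nu>) \<noteq> 0" for \<nu>
    by simp
  also have "\<dots> \<nu> \<longleftrightarrow> \<nu> \<in> (\<lambda>b. b \<bullet> (A *v b)) ` B" for \<nu>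
    using eigenbasis_finite by (auto simp: eigenbasis_dim_eigenspace)
  finally show ?thesis by blast
qed

text \<open>Links the multiplicities by eigenspace dimension, on which \<open>eigval\<close> rests,
  to the basis: the sorted list of eigenvalues then has exactly \<open>CARD('n)\<close> entries, all
  of them values on \<open>B\<close>.\<close>

lemma eigenbasis_eigenvalue_mset:
  "eigenvalue_mset A = image_mset (\<lambda>b. b \<bullet> (A *v b)) (mset_set B)"
proof (rule multiset_eqI)
  fix \<nu>
  have "count (eigenvalue_mset A) \<nu> = (if \<nu> \<in> eigenvalues A then dim (eigenspace A \<nu>) else 0)"
    using eigenbasis_finite
    by (simp add: eigenvalue_mset_def count_sum eigenbasis_eigenvalues)
  also have "\<dots> = card {b \<in> B. b \<bullet> (A *v b) = \<nu>}"
    unfolding eigenbasis_dim_eigenspace eigenbasis_eigenvalues using eigenbasis_finite by auto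
  also have "\<dots> = count (image_mset (\<lambda>b. b \<bullet> (A *v b)) (mset_set B)) \<nu>"
    using eigenbasis_finite by (simp add: count_image_mset' eq_commute)
  finally show "count (eigenvalue_mset A) \<nu> = \<dots>" .
qed

lemma eigenbasis_sorted_eigenvalues:
  shows "length (sorted_list_of_multiset (eigenvalue_mset A)) = CARD('n)"
    and "set (sorted_list_of_multiset (eigenvalue_mset A)) = (\<lambda>b. b \<bullet> (A *v b)) ` B"
  using eigenbasis_finite eigenbasis_card
  by (auto simp: eigenbasis_eigenvalue_mset simp flip: size_mset)

lemma eigenbasis_eigval_bounds:
  assumes "b \<in> B"
  shows "b \<bullet> (A *v b) \<le> eigval 1 A" and "eigval CARD('n) A \<le> b \<bullet> (A *v b)"
proof -
  define xs where "xs = sorted_list_of_multiset (eigenvalue_mset A)"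
  have len: "length xs = CARD('n)" and st: "set xs = (\<lambda>b. b \<bullet> (A *v b)) ` B"
    unfolding xs_def by (rule eigenbasis_sorted_eigenvalues)+
  have srt: "sorted xs" by (simp add: xs_def)
  obtain i where i: "i < CARD('n)" "xs ! i = b \<bullet> (A *v b)"
    using assms st len by (metis (no_types, lifting) imageI in_set_conv_nth)
  \<comment> \<open>\<open>xs\<close> is ascending and \<open>eigval\<close> reads it backwards from
    index \<open>i - 1\<close>, so \<open>eigval 1 A\<close> is the last entry and
    \<open>eigval CARD('n) A\<close> is entry \<open>0\<close>.\<close>
  have "xs ! i \<le> xs ! (CARD('n) - 1)" "xs ! 0 \<le> xs ! i"
    using i(1) srt len by (auto intro!: sorted_nth_mono)
  then show "b \<bullet> (A *v b) \<le> eigval 1 A" "eigval CARD('n) A \<le> b \<bullet> (A *v b)"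
    using i len by (simp_all add: eigval_def rev_nth flip: xs_def)
qed

lemma eigenbasis_eigval_mem:
  assumes "1 \<le> i" "i \<le> CARD('n)"
  shows "eigval i A \<in> (\<lambda>b. b \<bullet> (A *v b)) ` B"
proof -
  have "rev (sorted_list_of_multiset (eigenvalue_mset A)) ! (i - 1)
      \<in> set (rev (sorted_list_of_multiset (eigenvalue_mset A)))"
    using assms by (intro nth_mem) (simp add: eigenbasis_sorted_eigenvalues)
  then show ?thesis
    by (simp only: eigval_def set_rev eigenbasis_sorted_eigenvalues)
qed

end

text \<open>In eigenbasis coordinates the quadratic form is a sum of squares weighted by the
  eigenvalues, and replacing each weight by the extreme one leaves a multiple of the squared norm.
  The lower bound below works the same way.\<close>

lemma Rayleigh_le_eigval_1:
  fixes A :: "real^'n^'n"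
  assumes "symmetric_mat A"
  shows "x \<bullet> (A *v x) \<le> eigval 1 A * (x \<bullet> x)"
proof -
  obtain B where B: "eigenbasis A B" using symmetric_has_eigenbasis[OF assms] .
  show ?thesis
    unfolding eigenbasis_quadratic_form[OF B, of x] eigenbasis_norm[OF B, of x] sum_distrib_left
    by (intro sum_mono mult_right_mono eigenbasis_eigval_bounds[OF B]) auto
qed

lemma Rayleigh_ge_eigval_CARD:
  fixes A :: "real^'n^'n"
  assumes "symmetric_mat A"
  shows "eigval CARD('n) A * (x \<bullet> x) \<le> x \<bullet> (A *v x)"
proof -
  obtain B where B: "eigenbasis A B" using symmetric_has_eigenbasis[OF assms] .
  show ?thesis
    unfolding eigenbasis_quadratic_form[OF B, of x] eigenbasis_norm[OF B, of x] sum_distrib_left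
    by (intro sum_mono mult_right_mono eigenbasis_eigval_bounds[OF B]) auto
qed

lemma eigval_CARD_nonneg:
  fixes A :: "real^'n^'n"
  assumes "pos_semidef A"
  shows "0 \<le> eigval CARD('n) A"
proof -
  have "symmetric_mat A" using assms by (simp add: pos_semidef_def)
  then obtain B where "eigenbasis A B" by (rule symmetric_has_eigenbasis)
  then show ?thesis
    using eigenbasis_eigval_mem[of A B "CARD('n)"] assms by (auto simp: pos_semidef_def Suc_le_eq)
qed

section \<open>Square roots of positive semidefinite matrices\<close>

lemma symmetric_matI:
  fixes A :: "real^'n^'n"
  assumes "\<And>x y. x \<bullet> (A *v y) = (A *v x) \<bullet> y"
  shows "symmetric_mat A"
proof -
  have "transpose A *v y = A *v y" for y
    by (rule vector_eq_rdot[THEN iffD1]) (metis assms dot_transpose_mult inner_commute)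
  then show ?thesis
    by (simp add: symmetric_mat_def matrix_eq del: transpose_matrix_vector)
qed

text \<open>The root acts on an eigenbasis of \<open>A\<close> by the square roots of the
  eigenvalues, which are nonnegative.\<close>

lemma pos_semidef_has_sqrt:
  fixes A :: "real^'n^'n"
  assumes "pos_semidef A"
  shows "\<exists>S. pos_semidef S \<and> S ** S = A"
proof -
  from assms have "symmetric_mat A" by (simp add: pos_semidef_def)
  then obtain B where B: "eigenbasis A B" by (rule symmetric_has_eigenbasis)
  define \<mu> where "\<mu> b = b \<bullet> (A *v b)" for b
  have \<mu>: "0 \<le> \<mu> b" for b using assms by (simp add: \<mu>_def pos_semidef_def)
  define f where "f x = (\<Sum>b\<in>B. ((b \<bullet> x) * sqrt (\<mu> b)) *\<^sub>R b)" for x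
  have lin: "linear f"
    by (rule linearI) (simp_all add: f_def inner_add_right distrib_right scaleR_add_left sum.distrib
        scaleR_sum_right mult.assoc)
  define S where "S = matrix f"
  have S: "S *v x = f x" for x
    unfolding S_def by (rule matrix_works) (use lin in \<open>simp add: linear_matrix_vector_mul_eq\<close>)
  have coeff: "b \<bullet> f x = (b \<bullet> x) * sqrt (\<mu> b)" if "b \<in> B" for b x
    unfolding f_def by (rule eigenbasis_coeff[OF B that])
  \<comment> \<open>This expression is symmetric in \<open>x\<close> and \<open>y\<close> and a sum
    of nonnegative terms for \<open>x = y\<close>, so it yields both halves of
    semidefiniteness.\<close>
  have dot: "x \<bullet> f y = (\<Sum>b\<in>B. (b \<bullet> x) * (b \<bullet> y) * sqrt (\<mu> b))" for x y
    by (simp add: f_def inner_sum_right inner_commute mult_ac)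
  have "pos_semidef S"
    unfolding pos_semidef_def
  proof (intro conjI allI)
    have "x \<bullet> f y = y \<bullet> f x" for x y
      unfolding dot by (simp add: mult_ac)
    then show "symmetric_mat S"
      by (intro symmetric_matI) (simp only: S inner_commute)
    show "0 \<le> v \<bullet> (S *v v)" for v
      unfolding S dot using \<mu> by (intro sum_nonneg) simp
  qed
  moreover have "S ** S = A"
  proof -
    have "f (f x) = A *v x" for x
      unfolding eigenbasis_mult[OF B, of x]
      by (subst f_def, rule sum.cong) (use \<mu> in \<open>auto simp: coeff mult.assoc \<mu>_def\<close>)
    then show ?thesis
      by (simp add: matrix_eq S flip: matrix_vector_mul_assoc)
  qed
  ultimately show ?thesis by blast
qed

text \<open>It suffices to compare both roots on an eigenbasis of \<open>S\<close>. With existence,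
  this makes the description in \<open>sqrt_mat\<close> denote a root.\<close>

lemma pos_semidef_sqrt_unique:
  fixes S T :: "real^'n^'n"
  assumes S: "pos_semidef S" and T: "pos_semidef T" and eq: "S ** S = T ** T"
  shows "S = T"
proof -
  have sT: "symmetric_mat T" using T by (simp add: pos_semidef_def)
  from S have "symmetric_mat S" by (simp add: pos_semidef_def)
  then obtain B where B: "eigenbasis S B" by (rule symmetric_has_eigenbasis)
  have "S *v b = T *v b" if "b \<in> B" for b
  proof -
    define \<beta> where "\<beta> = b \<bullet> (S *v b)"
    have \<beta>: "0 \<le> \<beta>" using S by (simp add: \<beta>_def pos_semidef_def)
    have Sb: "S *v b = \<beta> *\<^sub>R b"
      unfolding \<beta>_def by (rule eigenbasis_eigen[OF B that])
    \<comment> \<open>\<open>T\<^sup>2 b = \<beta>\<^sup>2 b\<close> reads \<open>(T + \<beta>) w = 0\<close>, and \<open>T + \<beta>\<close> is injective unless \<open>\<beta> = 0\<close>.\<close>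
    define w where "w = T *v b - \<beta> *\<^sub>R b"
    have "T *v (T *v b) = S *v (S *v b)"
      by (simp add: matrix_vector_mul_assoc eq)
    then have Tw: "T *v w = - \<beta> *\<^sub>R w"
      by (simp add: w_def Sb algebra_simps)
    have "0 \<le> w \<bullet> (T *v w)" using T by (simp add: pos_semidef_def)
    then have "\<beta> = 0 \<or> w = 0"
      using \<beta> by (simp add: Tw mult_le_0_iff) (metis inner_gt_zero_iff not_less)
    \<comment> \<open>Settles the case \<open>\<beta> = 0\<close>: there \<open>T *v w = 0\<close>,
      and this identity forces \<open>w \<bullet> w = 0\<close>.\<close>
    moreover have "w \<bullet> w = (T *v w) \<bullet> b - \<beta> * (w \<bullet> b)"
      by (subst (2) w_def) (simp only: inner_diff_right inner_scaleR_right symmetric_mat_dot[OF sT])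
    ultimately have "w = 0" using Tw by auto
    then show ?thesis by (simp add: w_def Sb)
  qed
  then have "S *v x = T *v x" if "x \<in> span B" for x
    using linear_eq_on_span[OF matrix_vector_mul_linear matrix_vector_mul_linear _ that] by blast
  then show ?thesis
    using B by (simp add: matrix_eq eigenbasis_def)
qed

lemma sqrt_mat:
  fixes A :: "real^'n^'n"
  assumes "pos_semidef A"
  shows "pos_semidef (sqrt_mat A)" and "sqrt_mat A ** sqrt_mat A = A"
proof -
  have "\<exists>!S. pos_semidef S \<and> S ** S = A"
    using pos_semidef_has_sqrt[OF assms] pos_semidef_sqrt_unique by blast
  from theI'[OF this] show "pos_semidef (sqrt_mat A)" "sqrt_mat A ** sqrt_mat A = A"
    by (simp_all add: sqrt_mat_def)
qed

section \<open>Operator norms of the preconditioned Hessian and of its inverse\<close>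

lemma pos_semidef_congruence:
  fixes A :: "real^'n^'n" and N :: "real^'d^'n"
  assumes "pos_semidef A"
  shows "pos_semidef (transpose N ** A ** N)"
  unfolding pos_semidef_def
proof (intro conjI allI)
  have sA: "symmetric_mat A" using assms by (simp add: pos_semidef_def)
  have dot: "x \<bullet> ((transpose N ** A ** N) *v y) = (N *v x) \<bullet> (A *v (N *v y))" for x y
    by (simp add: dot_transpose_mult del: transpose_matrix_vector flip: matrix_vector_mul_assoc)
  show "symmetric_mat (transpose N ** A ** N)"
    by (rule symmetric_matI) (metis dot inner_commute symmetric_mat_dot[OF sA])
  show "0 \<le> v \<bullet> ((transpose N ** A ** N) *v v)" for v
    unfolding dot using assms by (simp add: pos_semidef_def)
qed

lemma pos_semidef_mat_1: "pos_semidef (mat 1)"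
  by (simp add: pos_semidef_def symmetric_mat_def)

text \<open>Cauchy-Schwarz for the form of \<open>A\<close>, applied to \<open>u = A *v v\<close>
  and \<open>v\<close>, bounds the fourth power of \<open>norm u\<close> by \<open>c * c\<close>
  times the squares of \<open>norm u\<close> and \<open>norm v\<close>; cancelling gives the norm
  bound.\<close>

lemma pos_semidef_op_norm_le:
  fixes A :: "real^'n^'n"
  assumes A: "pos_semidef A" and c: "0 \<le> c" "\<And>v. v \<bullet> (A *v v) \<le> c * (v \<bullet> v)"
  shows "op_norm A \<le> c"
  unfolding op_norm_def
proof (rule onorm_bound[OF c(1)])
  fix v
  let ?u = "A *v v"
  have sA: "symmetric_mat A" and nn: "\<And>v. 0 \<le> v \<bullet> (A *v v)"
    using A by (simp_all add: pos_semidef_def)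
  have "(?u \<bullet> ?u)\<^sup>2 \<le> (?u \<bullet> (A *v ?u)) * (v \<bullet> ?u)"
    by (rule psd_form_Cauchy_Schwarz[of "(*v) A" UNIV])
       (auto intro: symmetric_mat_dot[OF sA] nn)
  also have "\<dots> \<le> (c * (?u \<bullet> ?u)) * (c * (v \<bullet> v))"
    using c nn by (intro mult_mono) auto
  finally have "(?u \<bullet> ?u) * (?u \<bullet> ?u) \<le> (c\<^sup>2 * (v \<bullet> v)) * (?u \<bullet> ?u)"
    by (simp add: power2_eq_square mult_ac)
  then have "?u \<bullet> ?u \<le> c\<^sup>2 * (v \<bullet> v)"
    by (cases "?u = 0") auto
  then have "(norm ?u)\<^sup>2 \<le> (c * norm v)\<^sup>2"
    by (simp add: power_mult_distrib power2_norm_eq_inner)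
  then show "norm ?u \<le> c * norm v"
    by (rule power2_le_imp_le) (simp add: c(1))
qed

lemma matrix_inv_mult:
  fixes A :: "real^'n^'n"
  assumes "\<And>x. A *v x = 0 \<Longrightarrow> x = 0"
  shows "A *v (matrix_inv A *v x) = x" and "matrix_inv A *v (A *v x) = x"
proof -
  have "invertible A"
    using assms matrix_left_invertible_ker[of A] invertible_left_inverse[of A] by blast
  then have "A ** matrix_inv A = mat 1 \<and> matrix_inv A ** A = mat 1"
    unfolding invertible_def matrix_inv_def by (rule someI_ex)
  then show "A *v (matrix_inv A *v x) = x" "matrix_inv A *v (A *v x) = x"
    by (simp_all add: matrix_vector_mul_assoc)
qed

text \<open>The Gram identity \<open>LZ\<close> gives \<open>Z *v w\<close> the norm of
  \<open>L *v w\<close>, which is that of \<open>v\<close> for \<open>w = matrix_inv L *v v\<close>.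
  The Rayleigh bound of \<open>W\<close> thus bounds the quadratic form, and semidefiniteness turns
  this into a norm bound.\<close>

lemma precond_hessian_op_norm_le:
  fixes H L :: "real^'d^'d" and Z :: "real^'d^'n" and W :: "real^'n^'n"
  assumes H: "H = transpose Z ** W ** Z" and LZ: "transpose L ** L = transpose Z ** Z"
    and W: "pos_semidef W" and L: "\<And>x. L *v x = 0 \<Longrightarrow> x = 0"
  shows "op_norm (transpose (matrix_inv L) ** H ** matrix_inv L) \<le> eigval 1 W"
proof (rule pos_semidef_op_norm_le)
  have sW: "symmetric_mat W" using W by (simp add: pos_semidef_def)
  show "pos_semidef (transpose (matrix_inv L) ** H ** matrix_inv L)"
    unfolding H by (intro pos_semidef_congruence W)
  \<comment> \<open>The Rayleigh bound at any unit vector shows that the constant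
    \<open>eigval 1 W\<close> is nonnegative.\<close>
  let ?e = "axis undefined 1 :: real^'n"
  have "0 \<le> ?e \<bullet> (W *v ?e)"
    using W by (simp add: pos_semidef_def)
  also have "\<dots> \<le> eigval 1 W * (?e \<bullet> ?e)"
    by (rule Rayleigh_le_eigval_1[OF sW])
  finally show "0 \<le> eigval 1 W"
    by (simp add: inner_axis_axis)
  fix v
  let ?w = "matrix_inv L *v v"
  have "v \<bullet> ((transpose (matrix_inv L) ** H ** matrix_inv L) *v v) = (Z *v ?w) \<bullet> (W *v (Z *v ?w))"
    unfolding H
    by (simp add: dot_transpose_mult del: transpose_matrix_vector flip: matrix_vector_mul_assoc)
  also have "\<dots> \<le> eigval 1 W * ((Z *v ?w) \<bullet> (Z *v ?w))"
    by (rule Rayleigh_le_eigval_1[OF sW])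
  also have "(Z *v ?w) \<bullet> (Z *v ?w) = ?w \<bullet> ((transpose Z ** Z) *v ?w)"
    by (simp add: dot_transpose_mult del: transpose_matrix_vector flip: matrix_vector_mul_assoc)
  also have "\<dots> = (L *v ?w) \<bullet> (L *v ?w)"
    by (simp add: dot_transpose_mult flip: LZ matrix_vector_mul_assoc del: transpose_matrix_vector)
  also have "L *v ?w = v" by (rule matrix_inv_mult(1)[OF L])
  finally show "v \<bullet> ((transpose (matrix_inv L) ** H ** matrix_inv L) *v v) \<le> eigval 1 W * (v \<bullet> v)" .
qed

text \<open>For \<open>y = matrix_inv H *v (transpose L *v v)\<close> and \<open>u = L *v y\<close>
  the chain is \<open>l * (u \<bullet> u) \<le> y \<bullet> (H *v y) = u \<bullet> v\<close>, and
  Cauchy-Schwarz allows one factor \<open>norm u\<close> to be cancelled. A free lower bound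
  \<open>l\<close> lets one constant serve all points \<open>x\<close> at once.\<close>

lemma precond_inv_hessian_op_norm_le:
  fixes H L :: "real^'d^'d" and Z :: "real^'d^'n" and W :: "real^'n^'n"
  assumes H: "H = transpose Z ** W ** Z" and LZ: "transpose L ** L = transpose Z ** Z"
    and W: "symmetric_mat W" and l: "0 < l" "l \<le> eigval CARD('n) W"
    and inj: "\<And>x. H *v x = 0 \<Longrightarrow> x = 0"
  shows "op_norm (L ** matrix_inv H ** transpose L) \<le> inverse l"
  unfolding op_norm_def
proof (rule onorm_bound)
  show "0 \<le> inverse l" using l by simp
  fix v
  define y where "y = matrix_inv H *v (transpose L *v v)"
  let ?u = "L *v y"
  have "l * (?u \<bullet> ?u) = l * ((Z *v y) \<bullet> (Z *v y))"
    by (metis LZ dot_transpose_mult matrix_vector_mul_assoc)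
  also have "\<dots> \<le> eigval CARD('n) W * ((Z *v y) \<bullet> (Z *v y))"
    using l by (intro mult_right_mono) auto
  also have "\<dots> \<le> (Z *v y) \<bullet> (W *v (Z *v y))"
    by (rule Rayleigh_ge_eigval_CARD[OF W])
  also have "\<dots> = y \<bullet> (H *v y)"
    by (simp add: H dot_transpose_mult del: transpose_matrix_vector flip: matrix_vector_mul_assoc)
  also have "H *v y = transpose L *v v"
    unfolding y_def by (rule matrix_inv_mult(1)) (rule inj)
  also have "y \<bullet> (transpose L *v v) = ?u \<bullet> v" by (rule dot_transpose_mult)
  also have "\<dots> \<le> norm ?u * norm v" by (rule norm_cauchy_schwarz)
  finally have "norm ?u * (l * norm ?u) \<le> norm ?u * norm v"
    by (simp add: power2_eq_square mult_ac flip: power2_norm_eq_inner)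
  then have "l * norm ?u \<le> norm v"
    by (cases "?u = 0") auto
  then have "norm ?u \<le> inverse l * norm v"
    using l(1) by (simp add: field_simps)
  then show "norm ((L ** matrix_inv H ** transpose L) *v v) \<le> inverse l * norm v"
    by (simp add: y_def del: transpose_matrix_vector flip: matrix_vector_mul_assoc)
qed

section \<open>From pointwise bounds to the condition number\<close>

text \<open>\<open>a\<close> and \<open>b\<close> stand for the two operator norms, \<open>c\<close>
  and \<open>l\<close> for the extreme eigenvalues. A positive infimum \<open>r\<close> of
  \<open>l\<close> is a common lower bound, so \<open>inverse r\<close> bounds \<open>b\<close>
  uniformly; if the infimum is zero, the right-hand side is infinite.\<close>

lemma SUP_mult_SUP_le_SUP_divide_INF:
  fixes a b c l :: "'a \<Rightarrow> real"
  assumes c: "\<And>x. 0 < c x" and l: "\<And>x. 0 \<le> l x" and a: "\<And>x. a x \<le> c x"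
    and b: "\<And>x r. 0 < r \<Longrightarrow> r \<le> l x \<Longrightarrow> 0 \<le> b x \<and> b x \<le> inverse r"
  shows "(SUP x. ereal (a x)) * (SUP x. ereal (b x)) \<le> (SUP x. ereal (c x)) / (INF x. ereal (l x))"
proof (cases "(INF x. ereal (l x)) = 0")
  case True
  \<comment> \<open>\<open>y / 0 = \<infinity>\<close> in the extended reals only for \<open>y > 0\<close>.\<close>
  have "0 < (SUP x. ereal (c x))"
    using c by (intro less_SUP_iff[THEN iffD2]) auto
  then have "(SUP x. ereal (c x)) / (INF x. ereal (l x)) = \<infinity>"
    unfolding True by (simp add: divide_ereal_def)
  then show ?thesis by simp
next
  case False
  have "0 \<le> (INF x. ereal (l x))" using l by (intro INF_greatest) simp
  moreover have "(INF x. ereal (l x)) \<le> ereal (l undefined)" by (rule INF_lower) simp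
  ultimately obtain r where r: "(INF x. ereal (l x)) = ereal r" "0 < r"
    using False by (cases "INF x. ereal (l x)") auto
  have rl: "r \<le> l x" for x
    using INF_lower[of x UNIV "\<lambda>x. ereal (l x)"] r by simp
  have B: "(SUP x. ereal (b x)) \<le> ereal (inverse r)"
    using b[OF r(2) rl] by (intro SUP_least) simp
  have B0: "0 \<le> (SUP x. ereal (b x))"
    using b[OF r(2) rl] by (intro SUP_upper2[of undefined]) auto
  have C0: "0 \<le> (SUP x. ereal (c x))"
    using c by (intro SUP_upper2[of undefined]) (auto intro: less_imp_le)
  have "(SUP x. ereal (a x)) * (SUP x. ereal (b x)) \<le> (SUP x. ereal (c x)) * (SUP x. ereal (b x))"
    using a B0 by (intro ereal_mult_right_mono SUP_mono) auto
  also have "\<dots> \<le> (SUP x. ereal (c x)) * ereal (inverse r)"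
    using B C0 by (rule ereal_mult_left_mono)
  also have "\<dots> = (SUP x. ereal (c x)) / (INF x. ereal (l x))"
    using r by (simp add: divide_ereal_def)
  finally show ?thesis .
qed

text \<open>The common core of both parts: of the preconditioner only its Gram matrix
  \<open>transpose L ** L\<close> enters.\<close>

lemma precond_cond_number_le:
  fixes U :: "real^'d \<Rightarrow> real" and L :: "real^'d^'d" and Z :: "real^'d^'n"
    and \<Lambda> :: "real^'d \<Rightarrow> real^'n^'n"
  assumes pd: "\<And>x. pos_def (hessian U x)" and H: "\<And>x. hessian U x = transpose Z ** \<Lambda> x ** Z"
    and psd: "\<And>x. pos_semidef (\<Lambda> x)" and LZ: "transpose L ** L = transpose Z ** Z"
  shows "precond_cond_number U L
           \<le> (SUP x. ereal (eigval 1 (\<Lambda> x))) / (INF x. ereal (eigval CARD('n) (\<Lambda> x)))"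
  unfolding precond_cond_number_def
proof (rule SUP_mult_SUP_le_SUP_divide_INF)
  have sym: "symmetric_mat (\<Lambda> x)" for x using psd[of x] by (simp add: pos_semidef_def)
  have dot: "v \<bullet> (hessian U x *v v) = (Z *v v) \<bullet> (\<Lambda> x *v (Z *v v))" for x v
    by (simp add: H dot_transpose_mult del: transpose_matrix_vector flip: matrix_vector_mul_assoc)
  have inj: "v = 0" if "hessian U x *v v = 0" for x v
    using pd[of x] that unfolding pos_def_def by (metis inner_zero_right less_irrefl)
  \<comment> \<open>Equal Gram matrices give \<open>L\<close> and \<open>Z\<close> the same kernel,
    and a kernel vector of \<open>Z\<close> is annihilated by the positive definite Hessian.\<close>
  have L: "v = 0" if "L *v v = 0" for v
  proof -
    have "(Z *v v) \<bullet> (Z *v v) = (L *v v) \<bullet> (L *v v)"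
      by (metis LZ dot_transpose_mult matrix_vector_mul_assoc)
    then have "Z *v v = 0" using that by simp
    then show ?thesis using inj[of undefined v] by (simp add: H flip: matrix_vector_mul_assoc)
  qed
  fix x
  \<comment> \<open>Strictness matters where the infimum of the smallest eigenvalues is zero. It
    comes from positive definiteness of the Hessian, whose form at \<open>?v\<close> is that of
    \<open>\<Lambda> x\<close> at \<open>Z *v ?v\<close>.\<close>
  show "0 < eigval 1 (\<Lambda> x)"
  proof -
    let ?v = "axis undefined 1 :: real^'d"
    have "?v \<noteq> 0" by simp
    then have "0 < ?v \<bullet> (hessian U x *v ?v)"
      using pd[of x] by (simp add: pos_def_def)
    also have "\<dots> \<le> eigval 1 (\<Lambda> x) * ((Z *v ?v) \<bullet> (Z *v ?v))"
      unfolding dot by (rule Rayleigh_le_eigval_1[OF sym])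
    finally show ?thesis
      by (smt (verit) inner_ge_zero zero_less_mult_iff)
  qed
  show "0 \<le> eigval CARD('n) (\<Lambda> x)" by (rule eigval_CARD_nonneg[OF psd])
  show "op_norm (transpose (matrix_inv L) ** hessian U x ** matrix_inv L) \<le> eigval 1 (\<Lambda> x)"
    by (rule precond_hessian_op_norm_le[OF H LZ psd L])
  fix r :: real
  assume "0 < r" "r \<le> eigval CARD('n) (\<Lambda> x)"
  then show "0 \<le> op_norm (L ** matrix_inv (hessian U x) ** transpose L)
      \<and> op_norm (L ** matrix_inv (hessian U x) ** transpose L) \<le> inverse r"
    using precond_inv_hessian_op_norm_le[OF H LZ sym _ _ inj]
    by (simp add: op_norm_def onorm_pos_le linear_linear)
qed

section \<open>The bounds for the concrete preconditioners\<close>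

lemma well_conditioned_pos_def_hessian:
  fixes U :: "real^'d \<Rightarrow> real"
  assumes "well_conditioned P U"
  shows "pos_def (hessian U x)"
proof -
  obtain m where m: "0 < m" and lo: "mat m \<preceq>\<^sub>L hessian U x"
    using assms by (auto simp: well_conditioned_def)
  have mv: "mat m *v v = m *\<^sub>R v" for v :: "real^'d"
    by (simp add: vec_eq_iff mat_def matrix_vector_mult_def if_distrib[of "\<lambda>x. x * _"] cong: if_cong)
  have ps: "pos_semidef (hessian U x - mat m)" using lo by (simp add: loewner_le_def)
  \<comment> \<open>Symmetry of the Hessian is read off the Loewner bound, since
    \<open>pos_semidef\<close> includes symmetry of the difference.\<close>
  have "transpose (hessian U x - mat m) = transpose (hessian U x) - mat m"
    by (simp add: vec_eq_iff transpose_def mat_def)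
  then have "symmetric_mat (hessian U x)"
    using ps by (simp add: pos_semidef_def symmetric_mat_def)
  moreover have "0 < v \<bullet> (hessian U x *v v)" if "v \<noteq> 0" for v
  proof -
    have "0 \<le> v \<bullet> (hessian U x *v v) - m * (v \<bullet> v)"
      using ps by (simp add: pos_semidef_def matrix_vector_mult_diff_rdistrib inner_diff_right mv)
    moreover have "0 < m * (v \<bullet> v)" using m that by simp
    ultimately show ?thesis by linarith
  qed
  ultimately show ?thesis by (simp add: pos_def_def)
qed

text \<open>Semidefiniteness of every \<open>\<Lambda> x\<close> keeps the denominators nonnegative.
  For \<open>n > d\<close> the Hessian can be positive definite without it, and a negative infimum
  would make the quotient nonpositive although the condition number is positive. Definiteness of
  \<open>\<Lambda> xs\<close> makes its square root invertible.\<close>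

theorem mainTheorem12:
  fixes P :: "(real^('d::{finite,linorder})) measure"
    and U :: "real^('d::{finite,linorder}) \<Rightarrow> real"
    and Z :: "real^('d::{finite,linorder})^'n"
    and \<Lambda> :: "real^('d::{finite,linorder}) \<Rightarrow> real^'n^'n"
  assumes "well_conditioned P U"
    and "multiplicative_form U Z \<Lambda>"
    and "\<forall>x. pos_semidef (\<Lambda> x)"
  shows "(\<forall>L. L = sqrt_mat (transpose Z ** Z) \<or> (\<exists>Q. reduced_QR Z Q L) \<longrightarrow>
            precond_cond_number U L
              \<le> (SUP x. ereal (eigval 1 (\<Lambda> x))) / (INF x. ereal (eigval CARD('n) (\<Lambda> x))))
       \<and> (\<forall>xs. pos_def (\<Lambda> xs) \<longrightarrow>
            precond_cond_number U (sqrt_mat (transpose Z ** \<Lambda> xs ** Z))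
              \<le> (SUP x. ereal (eigval 1 (inv_sqrt_mat (\<Lambda> xs) ** \<Lambda> x ** inv_sqrt_mat (\<Lambda> xs))))
                / (INF x. ereal (eigval CARD('n) (inv_sqrt_mat (\<Lambda> xs) ** \<Lambda> x ** inv_sqrt_mat (\<Lambda> xs)))))"
proof (intro conjI allI impI)
  have pd: "pos_def (hessian U x)" for x
    by (rule well_conditioned_pos_def_hessian[OF assms(1)])
  have H: "hessian U x = transpose Z ** \<Lambda> x ** Z" for x
    using assms(2) by (simp add: multiplicative_form_def)
  have psd: "pos_semidef (\<Lambda> x)" for x using assms(3) by blast
  have sqrt_gram: "transpose (sqrt_mat A) ** sqrt_mat A = A" if "pos_semidef A" for A :: "real^'m^'m"
    using sqrt_mat[OF that] by (simp add: pos_semidef_def symmetric_mat_def)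
  {
    fix L assume "L = sqrt_mat (transpose Z ** Z) \<or> (\<exists>Q. reduced_QR Z Q L)"
    then have "transpose L ** L = transpose Z ** Z"
    proof
      assume "L = sqrt_mat (transpose Z ** Z)"
      then show ?thesis
        using sqrt_gram pos_semidef_congruence[OF pos_semidef_mat_1, of Z] by simp
    next
      assume "\<exists>Q. reduced_QR Z Q L"
      then obtain Q where "transpose Q ** Q = mat 1" "Z = Q ** L"
        by (auto simp: reduced_QR_def)
      \<comment> \<open>The orthonormal columns of \<open>Q\<close> cancel in
        \<open>transpose (Q ** L) ** (Q ** L)\<close>.\<close>
      then show ?thesis
        by (metis matrix_mul_assoc matrix_mul_lid matrix_transpose_mul)
    qed
    then show "precond_cond_number U L
        \<le> (SUP x. ereal (eigval 1 (\<Lambda> x))) / (INF x. ereal (eigval CARD('n) (\<Lambda> x)))"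
      by (rule precond_cond_number_le[OF pd H psd])
  }
  fix xs assume pdx: "pos_def (\<Lambda> xs)"
  define S where "S = sqrt_mat (\<Lambda> xs)"
  define N where "N = inv_sqrt_mat (\<Lambda> xs)"
  have SS: "S ** S = \<Lambda> xs" and psS: "pos_semidef S"
    using sqrt_mat[OF psd[of xs]] by (simp_all add: S_def)
  then have tS: "transpose S = S" by (simp add: pos_semidef_def symmetric_mat_def)
  have inj: "v = 0" if "S *v v = 0" for v
  proof -
    have "\<Lambda> xs *v v = 0" using that by (simp flip: SS matrix_vector_mul_assoc)
    then show ?thesis using pdx unfolding pos_def_def by (metis inner_zero_right less_irrefl)
  qed
  have SN: "S ** N = mat 1" and NS: "N ** S = mat 1"
    using matrix_inv_mult[OF inj]
    by (simp_all add: matrix_eq N_def inv_sqrt_mat_def flip: S_def matrix_vector_mul_assoc)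
  \<comment> \<open>Transposing \<open>S ** N = mat 1\<close> makes \<open>transpose N\<close> a
    left inverse of the symmetric \<open>S\<close>, hence equal to \<open>N\<close>.\<close>
  have tN: "transpose N = N"
    by (metis NS SN matrix_mul_assoc matrix_mul_rid matrix_transpose_mul tS transpose_mat)
  have "precond_cond_number U (sqrt_mat (transpose Z ** \<Lambda> xs ** Z))
      \<le> (SUP x. ereal (eigval 1 (N ** \<Lambda> x ** N))) / (INF x. ereal (eigval CARD('n) (N ** \<Lambda> x ** N)))"
  proof (rule precond_cond_number_le[OF pd])
    have "transpose (S ** Z) ** (N ** A ** N) ** (S ** Z)
        = transpose Z ** (S ** N) ** A ** (N ** S) ** Z" for A
      by (simp add: matrix_transpose_mul tS matrix_mul_assoc)
    then show "hessian U x = transpose (S ** Z) ** (N ** \<Lambda> x ** N) ** (S ** Z)" for x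
      by (simp add: H SN NS)
    show "pos_semidef (N ** \<Lambda> x ** N)" for x
      using pos_semidef_congruence[OF psd[of x], of N] by (simp add: tN)
    \<comment> \<open>Both sides equal \<open>transpose Z ** \<Lambda> xs ** Z\<close>: the left as
      the square of its root, the right by \<open>S ** S = \<Lambda> xs\<close>.\<close>
    show "transpose (sqrt_mat (transpose Z ** \<Lambda> xs ** Z)) ** sqrt_mat (transpose Z ** \<Lambda> xs ** Z)
        = transpose (S ** Z) ** (S ** Z)"
      unfolding sqrt_gram[OF pos_semidef_congruence[OF psd]]
      by (simp add: matrix_transpose_mul tS matrix_mul_assoc flip: SS)
  qed
  then show "precond_cond_number U (sqrt_mat (transpose Z ** \<Lambda> xs ** Z))
      \<le> (SUP x. ereal (eigval 1 (inv_sqrt_mat (\<Lambda> xs) ** \<Lambda> x ** inv_sqrt_mat (\<Lambda> xs))))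
        / (INF x. ereal (eigval CARD('n) (inv_sqrt_mat (\<Lambda> xs) ** \<Lambda> x ** inv_sqrt_mat (\<Lambda> xs))))"
    by (simp only: N_def)
qed

end
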